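(* Let $S$ be the set of positive integers congruent modulo $72$ to one of $\pm 1, \pm 3, \pm 5, \pm 7, \pm 8, \pm 9, \pm 10, \pm 11, \pm 12, \pm 13, \pm 14, \pm 16, \pm 17, \pm 18, \pm 19, \pm 23, \pm 25, \pm 27, \pm 29, \pm 31, \pm 32, \pm 33, \pm 34, \pm 35$, and let $T$ be the set of positive integers congruent modulo $72$ to one of $\pm 1, \pm 2, \pm 5, \pm 7, \pm 8, \pm 9, \pm 11, \pm 12, \pm 13, \pm 15, \pm 16, \pm 17, \pm 18, \pm 19, \pm 21, \pm 22, \pm 23, \pm 25, \pm 26, \pm 27, \pm 29, \pm 31, \pm 32, \pm 35$. Then $p(S,n)=p(T,n-1)$ for all integers $n\geq 1$.
   Context: For a set $S$ of positive integers and an integer $n\ge 0$, $p(S,n)$ denotes the number of partitions of $n$ into parts belonging to $S$ (so $p(S,0)=1$). *)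

theory Defs
  imports "HOL-Library.Multiset" "HOL-Number_Theory.Cong"
begin

text \<open>A partition of \<open>n\<close> into parts from \<open>S\<close> is a finite multiset of elements of \<open>S\<close> with sum \<open>n\<close>.
  If \<open>0 \<notin> S\<close>, there are only finitely many of them, so \<open>card\<close> is the actual count.\<close>

definition partition_count :: "nat set \<Rightarrow> nat \<Rightarrow> nat" where
  "partition_count S n = card {P :: nat multiset. set_mset P \<subseteq> S \<and> sum_mset P = n}"

definition pm_residue_class :: "nat \<Rightarrow> int set \<Rightarrow> nat set" where
  "pm_residue_class m R =
     {k. k > 0 \<and> (\<exists>r\<in>R. [int k = r] (mod int m) \<or> [int k = - r] (mod int m))}"

end

theory Submission
  imports Defs "HOL-Complex_Analysis.Complex_Analysis"
begin

text \<open>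
  Write $\theta(x) = \prod_{k \ge 0} (1 - x p^k)(1 - p^{k+1}/x)$ with $p = q^{12}$. After clearing
  denominators, the claim $\sum_n p(S,n) q^n - q \sum_n p(T,n) q^n = 1$ becomes a three-term relation
  between products of values of $\theta$ at $q^i \zeta$, where $\zeta$ is a sixth root of unity: the
  parts that $S$ and $T$ do not share form the products
  $\theta(q)\theta(-q)$, $\theta(q^5)\theta(-q^5)$ (residues modulo 24) and
  $\prod_{j} \theta(\omega^j q)$, $\prod_{j} \theta(\omega^j q^5)$ (residues modulo 36), with
  $\omega$ a primitive cube root of unity. The resulting relation is exactly
  Weierstrass' three-term relation for the four points $\omega$, $-q^2$, $q^5$, $q$.

  The three-term relation itself is a Pluecker relation: by the Jacobi triple product,
  $\theta(xy)\theta(x/y)/x$ is a $2 \times 2$ determinant $Q(x)P(y) - P(x)Q(y)$.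
\<close>

section \<open>Tools on infinite products and dominated convergence\<close>

lemma convergent_prod_one_minus:
  fixes a :: "nat \<Rightarrow> complex"
  assumes "summable (\<lambda>n. norm (a n))"
  shows "convergent_prod (\<lambda>n. 1 - a n)"
  by (intro abs_convergent_prod_imp_convergent_prod summable_imp_abs_convergent_prod)
    (use assms in simp)

lemma prodinf_LIMSEQ:
  fixes f :: "nat \<Rightarrow> complex"
  assumes "convergent_prod f"
  shows "(\<lambda>n. \<Prod>i<n. f i) \<longlonglongrightarrow> prodinf f"
  using assms by (intro has_prod_imp_tendsto') auto

text \<open>Lebesgue's theorem for the counting measure on \<open>A\<close>, carried over from
  integrals to \<open>infsum\<close>. It serves twice: in the triple product and in the generating
  functions of partitions.\<close>

lemma infsum_dominated_convergence:
  fixes f :: "nat \<Rightarrow> 'a \<Rightarrow> complex"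
  assumes h: "h summable_on A"
    and lim: "\<And>x. x \<in> A \<Longrightarrow> (\<lambda>n. f n x) \<longlonglongrightarrow> g x"
    and bound: "\<And>n x. x \<in> A \<Longrightarrow> norm (f n x) \<le> h x"
  shows "(\<lambda>n. infsum (f n) A) \<longlonglongrightarrow> infsum g A" and "(\<lambda>x. norm (g x)) summable_on A"
proof -
  have gh: "norm (g x) \<le> h x" if "x \<in> A" for x
    by (rule tendsto_upperbound[OF tendsto_norm[OF lim[OF that]]]) (use bound that in auto)
  have absg: "(\<lambda>x. norm (g x)) summable_on A"
    by (rule Infinite_Sum.abs_summable_on_comparison_test'[OF h gh])
  have absf: "(\<lambda>x. norm (f n x)) summable_on A" for n
    by (rule Infinite_Sum.abs_summable_on_comparison_test'[OF h bound])
  show "(\<lambda>x. norm (g x)) summable_on A" by fact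
  have h': "(\<lambda>x. norm (h x)) summable_on A"
    by (rule summable_on_iff_abs_summable_on_real[THEN iffD1, OF h])
  have "integrable (count_space A) h"
    using h' unfolding abs_summable_equivalent Infinite_Set_Sum.abs_summable_on_def .
  then have "(\<lambda>n. integral\<^sup>L (count_space A) (f n)) \<longlonglongrightarrow> integral\<^sup>L (count_space A) g"
    by (intro integral_dominated_convergence[where w = h])
      (auto simp: AE_count_space lim bound)
  then show "(\<lambda>n. infsum (f n) A) \<longlonglongrightarrow> infsum g A"
    using absf absg by (simp add: abs_summable_equivalent infsetsum_def flip: infsetsum_infsum)
qed

subsection \<open>The Jacobi triple product\<close>

definition qfact :: "complex \<Rightarrow> nat \<Rightarrow> complex" where
  "qfact p n = (\<Prod>k<n. 1 - p ^ Suc k)"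

text \<open>The Gaussian binomial coefficient. For \<open>j > n\<close> the truncated subtraction
  gives \<open>qfact p n / qfact p j\<close> instead of the customary 0, so the top index needs
  separate treatment in recurrences.\<close>

definition qbinom :: "complex \<Rightarrow> nat \<Rightarrow> nat \<Rightarrow> complex" where
  "qbinom p n j = qfact p n / (qfact p j * qfact p (n - j))"

lemma one_minus_power_nonzero:
  fixes p :: complex
  assumes "norm p < 1" "n > 0"
  shows "1 - p ^ n \<noteq> 0"
proof
  assume "1 - p ^ n = 0"
  then have "norm p ^ n = 1" by (metis norm_one norm_power right_minus_eq)
  with assms show False using power_less_one_iff[of "norm p" n] by simp
qed

lemma qfact_nonzero: "norm p < 1 \<Longrightarrow> qfact p n \<noteq> 0"
  using one_minus_power_nonzero[of p "Suc _"] by (auto simp: qfact_def simp del: power_Suc)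

lemma qfact_Suc: "qfact p (Suc n) = qfact p n * (1 - p ^ Suc n)"
  by (simp add: qfact_def)

lemma qbinom_0: "norm p < 1 \<Longrightarrow> qbinom p n 0 = 1"
  using qfact_nonzero[of p n] by (simp add: qbinom_def qfact_def)

lemma qbinom_self: "norm p < 1 \<Longrightarrow> qbinom p n n = 1"
  using qfact_nonzero[of p n] by (simp add: qbinom_def qfact_def)

text \<open>The q-Pascal rule. With P = p^(n-j) and Q = p^(j+1), removing common factors leaves 1 -
  PQ = (1 - P) + P(1 - Q).\<close>

lemma qbinom_Suc_Suc:
  assumes "norm p < 1" "j < n"
  shows "qbinom p (Suc n) (Suc j) = qbinom p n (Suc j) + p ^ (n - j) * qbinom p n j"
proof -
  obtain d where n: "n = Suc (j + d)" using assms(2) less_imp_Suc_add by auto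
  have pp: "p ^ Suc n = p ^ Suc d * p ^ Suc j" by (simp add: n add.commute flip: power_add)
  have nz: "1 - p ^ Suc j \<noteq> 0" "1 - p ^ Suc d \<noteq> 0" "qfact p j \<noteq> 0" "qfact p d \<noteq> 0"
    using one_minus_power_nonzero[of p] qfact_nonzero assms(1) by (auto simp del: power_Suc)
  have e: "Suc n - Suc j = Suc d" "n - Suc j = d" "n - j = Suc d" by (simp_all add: n)
  have frac: "F * (1 - P * Q) / (a * (1 - Q) * (b * (1 - P))) =
      F / (a * (1 - Q) * b) + P * (F / (a * (b * (1 - P))))"
    if "1 - Q \<noteq> 0" "1 - P \<noteq> 0" "a \<noteq> 0" "b \<noteq> 0" for F P Q a b :: complex
    using that by (simp add: divide_simps) algebra
  show ?thesis
    unfolding qbinom_def e qfact_Suc pp by (rule frac) (use nz in auto)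
qed

text \<open>Induction on the number of factors: multiplying by the new factor 1 - x p^n produces the
  two terms of the q-Pascal rule.\<close>

lemma qbinomial_theorem:
  assumes "norm p < 1"
  shows "(\<Prod>k<n. 1 - x * p ^ k) = (\<Sum>j\<le>n. (- x) ^ j * p ^ (j choose 2) * qbinom p n j)"
proof (induction n)
  case 0
  then show ?case using assms by (simp add: qbinom_0 numeral_2_eq_2)
next
  case (Suc n)
  let ?t = "\<lambda>n j. (- x) ^ j * p ^ (j choose 2) * qbinom p n j"
  have step: "?t (Suc n) (Suc j) = ?t n (Suc j) + (- x * p ^ n) * ?t n j" if "j < n" for j
  proof -
    have "p ^ (Suc j choose 2) * p ^ (n - j) = p ^ n * p ^ (j choose 2)"
      using that by (simp add: numeral_2_eq_2 add.commute flip: power_add)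
    then show ?thesis
      by (simp add: qbinom_Suc_Suc[OF assms that] algebra_simps)
  qed
  have last: "?t (Suc n) (Suc n) = (- x * p ^ n) * ?t n n"
    using assms by (simp add: qbinom_self numeral_2_eq_2 power_add)
  have "(\<Sum>j\<le>Suc n. ?t (Suc n) j) = 1 + (\<Sum>j<n. ?t (Suc n) (Suc j)) + ?t (Suc n) (Suc n)"
    unfolding sum.atMost_Suc_shift unfolding lessThan_Suc_atMost[symmetric] sum.lessThan_Suc
    using assms by (simp add: qbinom_0 numeral_2_eq_2)
  also have "\<dots> = (1 + (\<Sum>j<n. ?t n (Suc j))) + (- x * p ^ n) * ((\<Sum>j<n. ?t n j) + ?t n n)"
  proof -
    have "(\<Sum>j<n. ?t (Suc n) (Suc j)) = (\<Sum>j<n. ?t n (Suc j) + (- x * p ^ n) * ?t n j)"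
      by (intro sum.cong refl step) simp
    then show ?thesis
      by (simp only: last sum.distrib sum_distrib_left distrib_left add.assoc)
  qed
  also have "1 + (\<Sum>j<n. ?t n (Suc j)) = (\<Sum>j\<le>n. ?t n j)"
    using assms by (subst sum.atMost_shift) (simp add: qbinom_0 numeral_2_eq_2)
  also have "(\<Sum>j<n. ?t n j) + ?t n n = (\<Sum>j\<le>n. ?t n j)"
    by (simp flip: lessThan_Suc_atMost)
  finally show ?case using Suc.IH by (simp add: algebra_simps)
qed

lemma int_choose_two: "int (k choose 2) = int k * (int k - 1) div 2"
  by (cases k) (simp_all add: choose_two zdiv_int algebra_simps)

text \<open>Completing the square: with T(j) = j(j-1)/2, shifting the index by n absorbs the linear
  term nj up to a constant. All the halved products are even, so \<open>div\<close> is
  exact.\<close>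

lemma triangular_diff:
  fixes j n :: int
  shows "j * (j - 1) div 2 - n * j = (j - n) * (j - n - 1) div 2 - (n + 1) * n div 2"
proof -
  have "even ((j - n) * (j - n - 1))" "even ((n + 1) * n)" by auto
  then obtain a b where ab: "(j - n) * (j - n - 1) = 2 * a" "(n + 1) * n = 2 * b" by (elim evenE)
  have "j * (j - 1) = (j - n) * (j - n - 1) - (n + 1) * n + 2 * (n * j)" by algebra
  then have "j * (j - 1) = 2 * (a - b + n * j)" unfolding ab by simp
  then show ?thesis unfolding ab by simp
qed

text \<open>The exponents 1, ..., n add up to a triangular number. This is the constant that comes
  out when half of the q-binomial product is inverted.\<close>

lemma prod_neg_div_power:
  fixes p x :: complex
  shows "(\<Prod>k<n. - x / p ^ Suc k) = (- x) ^ n / p ^ (Suc n choose 2)"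
  by (induction n) (simp_all add: numeral_2_eq_2 power_add mult_ac)

text \<open>The general term of the two-sided theta series; m(m-1) is even, so \<open>div\<close> is
  exact for negative m as well.\<close>

definition jacobi_term :: "complex \<Rightarrow> complex \<Rightarrow> int \<Rightarrow> complex" where
  "jacobi_term p x m = p powi (m * (m - 1) div 2) * (- x) powi m"

lemma prod_lessThan_add:
  fixes f :: "nat \<Rightarrow> 'a::comm_monoid_mult"
  shows "(\<Prod>k<m + n. f k) = (\<Prod>k<m. f k) * (\<Prod>k<n. f (m + k))"
  by (induction n) (simp_all add: mult.assoc)

text \<open>The q-binomial theorem with 2n factors is applied at x/p^n and re-centred by m = j - n.
  The upper n factors are already 1 - x p^k; the lower n carry negative powers of p and are inverted
  at the cost of the constant \<open>c\<close>, which also comes out of the coefficients.\<close>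

lemma finite_jacobi_triple_product:
  assumes p: "norm p < 1" "p \<noteq> 0" and x: "x \<noteq> 0"
  shows "(\<Prod>k<n. (1 - x * p ^ k) * (1 - p ^ Suc k / x)) =
    (\<Sum>m\<in>{- int n..int n}. jacobi_term p x m * qbinom p (2 * n) (nat (int n + m)))"
proof -
  define y where "y = x / p ^ n"
  define c where "c = (- x) ^ n / p ^ (Suc n choose 2)"
  have "c \<noteq> 0" using p x by (simp add: c_def)
  \<comment> \<open>The order of the factors is reversed, so that the k-th one becomes 1 -
    x/p^(k+1).\<close>
  have "(\<Prod>k<n. 1 - y * p ^ k) = (\<Prod>k<n. 1 - y * p ^ (n - Suc k))"
    by (rule prod.nat_diff_reindex[symmetric])
  also have "\<dots> = (\<Prod>k<n. (- x / p ^ Suc k) * (1 - p ^ Suc k / x))"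
  proof (intro prod.cong refl)
    fix k assume "k \<in> {..<n}"
    then have "p ^ n = p ^ (n - Suc k) * p ^ Suc k"
      by (metis add.commute le_add_diff_inverse lessThan_iff Suc_leI power_add)
    then show "1 - y * p ^ (n - Suc k) = (- x / p ^ Suc k) * (1 - p ^ Suc k / x)"
      using p x by (simp add: y_def divide_simps del: power_Suc)
  qed
  also have "\<dots> = c * (\<Prod>k<n. 1 - p ^ Suc k / x)"
    unfolding prod.distrib prod_neg_div_power c_def ..
  finally have lower: "(\<Prod>k<n. 1 - y * p ^ k) = c * (\<Prod>k<n. 1 - p ^ Suc k / x)" .
  have upper: "(\<Prod>k<n. 1 - y * p ^ (n + k)) = (\<Prod>k<n. 1 - x * p ^ k)"
    using p by (intro prod.cong refl) (simp add: y_def power_add)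
  have split: "(\<Prod>k<2 * n. 1 - y * p ^ k) = (\<Prod>k<n. 1 - y * p ^ k) * (\<Prod>k<n. 1 - y * p ^ (n + k))"
    unfolding mult_2 by (rule prod_lessThan_add)
  have coeff: "(- y) ^ j * p ^ (j choose 2) = c * jacobi_term p x (int j - int n)" for j
  proof -
    let ?T = "\<lambda>m::int. m * (m - 1) div 2"
    have "?T (int j) - int n * int j = ?T (int j - int n) - ?T (int (Suc n))"
      using triangular_diff[of "int j" "int n"] by (simp add: add.commute)
    then have T: "p powi (?T (int j)) / p powi (int n * int j) =
        p powi (?T (int j - int n)) / p powi (?T (int (Suc n)))"
      using p by (simp flip: power_int_diff)
    have c: "c = (- x) ^ n / p powi (?T (int (Suc n)))"
      unfolding c_def int_choose_two[symmetric] power_int_of_nat ..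
    have pj: "p ^ (j choose 2) = p powi (?T (int j))"
      unfolding int_choose_two[symmetric] power_int_of_nat ..
    have pn: "(p ^ n) ^ j = p powi (int n * int j)"
      by (metis power_mult power_int_of_nat of_nat_mult)
    have xj: "(- x) ^ j = (- x) ^ n * (- x) powi (int j - int n)"
      using x by (simp add: power_int_diff)
    have "(- y) ^ j * p ^ (j choose 2) = (- x) ^ j * (p powi (?T (int j)) / (p ^ n) ^ j)"
      unfolding y_def minus_divide_left power_divide pj by simp
    also have "\<dots> = ((- x) ^ n * (- x) powi (int j - int n)) *
        (p powi (?T (int j - int n)) / p powi (?T (int (Suc n))))"
      unfolding pn T xj ..
    also have "\<dots> = c * jacobi_term p x (int j - int n)"
      unfolding c jacobi_term_def times_divide_eq_left times_divide_eq_right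
      by (simp only: mult_ac)
    finally show ?thesis .
  qed
  have "c * (\<Prod>k<n. (1 - x * p ^ k) * (1 - p ^ Suc k / x)) = (\<Prod>k<2 * n. 1 - y * p ^ k)"
    unfolding split lower upper by (simp add: prod.distrib)
  also have "\<dots> = (\<Sum>j\<le>2 * n. (- y) ^ j * p ^ (j choose 2) * qbinom p (2 * n) j)"
    by (rule qbinomial_theorem[OF p(1)])
  also have "\<dots> = c * (\<Sum>j\<le>2 * n. jacobi_term p x (int j - int n) * qbinom p (2 * n) j)"
    by (simp add: coeff sum_distrib_left mult.assoc)
  also have "(\<Sum>j\<le>2 * n. jacobi_term p x (int j - int n) * qbinom p (2 * n) j) =
     (\<Sum>m\<in>{- int n..int n}. jacobi_term p x m * qbinom p (2 * n) (nat (int n + m)))"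
    by (rule sum.reindex_bij_witness[of _ "\<lambda>m. nat (int n + m)" "\<lambda>j. int j - int n"]) auto
  finally show ?thesis using \<open>c \<noteq> 0\<close> by simp
qed

section \<open>Passage to the limit in the finite triple product\<close>

lemma summable_power_choose_two:
  fixes r y :: real
  assumes "0 \<le> r" "r < 1" "0 \<le> y"
  shows "summable (\<lambda>k. r ^ (k choose 2) * y ^ k)"
proof -
  have "(\<lambda>k. r ^ k * y) \<longlonglongrightarrow> 0"
    using assms by (intro tendsto_mult_left_zero LIMSEQ_power_zero) auto
  then have "eventually (\<lambda>k. r ^ k * y < 1 / 2) sequentially"
    by (rule order_tendstoD) simp
  then obtain N where N: "\<And>k. k \<ge> N \<Longrightarrow> r ^ k * y < 1 / 2"
    by (auto simp: eventually_sequentially)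
  show ?thesis
  proof (rule summable_ratio_test[of "1 / 2" N])
    fix k assume "N \<le> k"
    have "r ^ (Suc k choose 2) * y ^ Suc k = (r ^ k * y) * (r ^ (k choose 2) * y ^ k)"
      by (simp add: numeral_2_eq_2 power_add)
    also have "\<dots> \<le> 1 / 2 * (r ^ (k choose 2) * y ^ k)"
      using N[OF \<open>N \<le> k\<close>] assms by (intro mult_right_mono) auto
    finally show "norm (r ^ (Suc k choose 2) * y ^ Suc k) \<le> 1 / 2 * norm (r ^ (k choose 2) * y ^ k)"
      using assms by (simp add: abs_mult power_abs)
  qed simp
qed

text \<open>The two half-lines are treated apart. At m = -k the exponent of p is (k choose 2) + k,
  so both halves fall under \<open>summable_power_choose_two\<close>, with y = |x| and y =
  |p|/|x|.\<close>

lemma jacobi_term_abs_summable: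
  assumes p: "norm p < 1" "p \<noteq> 0" and x: "x \<noteq> 0"
  shows "(\<lambda>m. norm (jacobi_term p x m)) summable_on UNIV"
proof -
  have nonneg: "norm (jacobi_term p x (int k)) = norm p ^ (k choose 2) * norm x ^ k" for k
    by (simp add: jacobi_term_def norm_mult norm_power flip: int_choose_two)
  have neg: "norm (jacobi_term p x (- int k)) = norm p ^ (k choose 2) * (norm p / norm x) ^ k" for k
  proof -
    have T: "- int k * (- int k - 1) div 2 = int ((k choose 2) + k)"
      using int_choose_two[of "Suc k"] by (simp add: numeral_2_eq_2 algebra_simps)
    show ?thesis
      unfolding jacobi_term_def T power_int_of_nat
      by (simp add: norm_mult power_int_minus norm_power power_add power_divide norm_inverse
          divide_inverse power_mult_distrib power_inverse)
  qed
  have "(\<lambda>m. norm (jacobi_term p x m)) summable_on range int"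
    by (subst summable_on_reindex)
      (auto simp: o_def nonneg norm_mult norm_power intro!: summable_nonneg_imp_summable_on summable_power_choose_two p)
  moreover have "(\<lambda>m. norm (jacobi_term p x m)) summable_on range (\<lambda>k. - int k)"
    by (subst summable_on_reindex)
      (auto simp: o_def neg norm_mult norm_power inj_on_def intro!: summable_nonneg_imp_summable_on summable_power_choose_two p)
  moreover have "range int \<union> range (\<lambda>k. - int k) = UNIV"
    by (auto simp: image_iff) (metis int_cases2)
  ultimately show ?thesis
    using summable_on_union by fastforce
qed

text \<open>The modified theta function (x; p)_inf (p/x; p)_inf. The third factor (p; p)_inf of the
  triple product is left out and enters below as the constant \<open>L\<close>.\<close>

definition theta :: "complex \<Rightarrow> complex \<Rightarrow> complex" where
  "theta p x = (\<Prod>k. (1 - x * p ^ k) * (1 - p ^ Suc k / x))"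

lemma convergent_prod_theta:
  fixes p x :: complex
  assumes "norm p < 1"
  shows "convergent_prod (\<lambda>k. (1 - x * p ^ k) * (1 - p ^ Suc k / x))"
proof (rule convergent_prod_mult; rule convergent_prod_one_minus)
  show "summable (\<lambda>k. norm (x * p ^ k))"
    using assms by (auto simp: norm_mult norm_power intro!: summable_mult summable_geometric)
  show "summable (\<lambda>k. norm (p ^ Suc k / x))"
    using assms by (auto simp: norm_mult norm_power norm_divide
        intro!: summable_mult summable_divide summable_geometric)
qed

lemma theta_LIMSEQ:
  assumes "norm p < 1"
  shows "(\<lambda>n. \<Prod>k<n. (1 - x * p ^ k) * (1 - p ^ Suc k / x)) \<longlonglongrightarrow> theta p x"
  unfolding theta_def by (rule prodinf_LIMSEQ[OF convergent_prod_theta[OF assms]])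

lemma qfact_LIMSEQ:
  assumes "norm p < 1"
  obtains L where "L \<noteq> 0" "(\<lambda>n. qfact p n) \<longlonglongrightarrow> L"
proof
  have c: "convergent_prod (\<lambda>k. 1 - p ^ Suc k)"
    using assms by (intro convergent_prod_one_minus)
      (auto simp: norm_mult norm_power intro!: summable_mult summable_geometric)
  show "(\<lambda>n. qfact p n) \<longlonglongrightarrow> (\<Prod>k. 1 - p ^ Suc k)"
    unfolding qfact_def by (rule prodinf_LIMSEQ[OF c])
  show "(\<Prod>k. 1 - p ^ Suc k) \<noteq> 0"
    using one_minus_power_nonzero[OF assms] by (intro prodinf_nonzero[OF c]) (simp del: power_Suc)
qed

text \<open>The finite identity is taken to the limit. Its q-binomial weights tend to 1/L with L =
  (p; p)_inf, and they are bounded uniformly because \<open>qfact p\<close> is bounded and bounded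
  away from 0. One \<open>L\<close> serves all x, so that products of theta values can be
  compared.\<close>

theorem jacobi_triple_product:
  assumes p: "norm p < 1" "p \<noteq> 0"
  obtains L where "L \<noteq> 0"
    "\<And>x. x \<noteq> 0 \<Longrightarrow> (jacobi_term p x has_sum L * theta p x) UNIV"
proof -
  obtain L where L: "L \<noteq> 0" "(\<lambda>n. qfact p n) \<longlonglongrightarrow> L"
    using qfact_LIMSEQ[OF p(1)] by blast
  have "Bseq (qfact p)" using L(2) by (metis convergentI convergent_imp_Bseq)
  then obtain K1 where K1: "K1 > 0" "\<And>n. norm (qfact p n) \<le> K1" by (auto simp: Bseq_def)
  have "(\<lambda>n. inverse (qfact p n)) \<longlonglongrightarrow> inverse L" using L by (intro tendsto_inverse)
  then have "Bseq (\<lambda>n. inverse (qfact p n))" by (metis convergentI convergent_imp_Bseq)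
  then obtain K2 where K2: "K2 > 0" "\<And>n. norm (inverse (qfact p n)) \<le> K2" by (auto simp: Bseq_def)
  have bound: "norm (qbinom p n j) \<le> K1 * (K2 * K2)" for n j
    unfolding qbinom_def divide_inverse inverse_mult_distrib norm_mult
    using K1 K2 by (intro mult_mono) auto
  have qb: "(\<lambda>n. qbinom p (2 * n) (nat (int n + m))) \<longlonglongrightarrow> inverse L" for m
  proof -
    have lims: "(\<lambda>n. qfact p (2 * n)) \<longlonglongrightarrow> L" "(\<lambda>n. qfact p (nat (int n + m))) \<longlonglongrightarrow> L"
      "(\<lambda>n. qfact p (2 * n - nat (int n + m))) \<longlonglongrightarrow> L"
    proof -
      show "(\<lambda>n. qfact p (2 * n)) \<longlonglongrightarrow> L"
        by (rule filterlim_compose[OF L(2)]) (simp add: mult_nat_left_at_top)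
      show "(\<lambda>n. qfact p (nat (int n + m))) \<longlonglongrightarrow> L"
      proof (rule filterlim_compose[OF L(2)], unfold filterlim_at_top eventually_sequentially, intro allI exI impI)
        fix Z n assume "Z + nat \<bar>m\<bar> \<le> n" then show "Z \<le> nat (int n + m)" by linarith
      qed
      show "(\<lambda>n. qfact p (2 * n - nat (int n + m))) \<longlonglongrightarrow> L"
      proof (rule filterlim_compose[OF L(2)], unfold filterlim_at_top eventually_sequentially, intro allI exI impI)
        fix Z n assume "Z + nat \<bar>m\<bar> \<le> n" then show "Z \<le> 2 * n - nat (int n + m)" by linarith
      qed
    qed
    have "(\<lambda>n. qbinom p (2 * n) (nat (int n + m))) \<longlonglongrightarrow> L / (L * L)"
      unfolding qbinom_def by (intro tendsto_intros lims) (use L in auto)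
    then show ?thesis using L by (simp add: field_simps)
  qed
  have main: "(jacobi_term p x has_sum L * theta p x) UNIV" if x: "x \<noteq> 0" for x
  proof -
    \<comment> \<open>Extension by zero puts all finite sums on the common index set of the
      integers, as dominated convergence requires.\<close>
    define f where "f n m = (if m \<in> {- int n..int n} then jacobi_term p x m * qbinom p (2 * n) (nat (int n + m)) else 0)" for n m
    have sum: "(\<lambda>m. norm (jacobi_term p x m)) summable_on UNIV"
      by (rule jacobi_term_abs_summable[OF p x])
    have inf: "infsum (f n) UNIV = (\<Prod>k<n. (1 - x * p ^ k) * (1 - p ^ Suc k / x))" for n
    proof -
      have "infsum (f n) UNIV = infsum (f n) {- int n..int n}"
        by (rule infsum_cong_neutral) (auto simp: f_def)
      also have "\<dots> = (\<Sum>m\<in>{- int n..int n}. jacobi_term p x m * qbinom p (2 * n) (nat (int n + m)))"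
        unfolding infsum_finite[OF finite_atLeastAtMost_int] by (intro sum.cong refl) (simp add: f_def)
      finally show ?thesis unfolding finite_jacobi_triple_product[OF p x] .
    qed
    have lim: "(\<lambda>n. f n m) \<longlonglongrightarrow> jacobi_term p x m * inverse L" for m
    proof (rule Lim_transform_eventually)
      show "(\<lambda>n. jacobi_term p x m * qbinom p (2 * n) (nat (int n + m))) \<longlonglongrightarrow> jacobi_term p x m * inverse L"
        by (intro tendsto_intros qb)
      show "\<forall>\<^sub>F n in sequentially. jacobi_term p x m * qbinom p (2 * n) (nat (int n + m)) = f n m"
        unfolding eventually_sequentially by (intro exI[of _ "nat \<bar>m\<bar>"]) (auto simp: f_def)
    qed
    have "(\<lambda>n. infsum (f n) UNIV) \<longlonglongrightarrow> infsum (\<lambda>m. jacobi_term p x m * inverse L) UNIV"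
    proof (rule infsum_dominated_convergence[where h = "\<lambda>m. norm (jacobi_term p x m) * (K1 * (K2 * K2))"])
      show "(\<lambda>m. norm (jacobi_term p x m) * (K1 * (K2 * K2))) summable_on UNIV"
        by (intro summable_on_cmult_left sum)
      show "norm (f n m) \<le> norm (jacobi_term p x m) * (K1 * (K2 * K2))" for n m
        using K1(1) K2(1) mult_left_mono[OF bound norm_ge_zero, of "jacobi_term p x m"]
        by (simp add: f_def norm_mult)
    qed (rule lim)
    then have "infsum (\<lambda>m. jacobi_term p x m * inverse L) UNIV = theta p x"
      unfolding inf by (rule LIMSEQ_unique) (rule theta_LIMSEQ[OF p(1)])
    moreover have "infsum (\<lambda>m. jacobi_term p x m * inverse L) UNIV = infsum (jacobi_term p x) UNIV * inverse L"
      by (rule infsum_cmult_left')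
    ultimately have "infsum (jacobi_term p x) UNIV = L * theta p x"
      using L(1) by (simp add: divide_simps mult.commute)
    moreover have "jacobi_term p x summable_on UNIV" using sum by (rule abs_summable_summable)
    ultimately show ?thesis by (simp add: has_sum_iff)
  qed
  show ?thesis using that[OF L(1) main] .
qed

subsection \<open>The three-term relation\<close>

text \<open>Fubini: the norms in row x add up to a constant multiple of \<open>norm (f x)\<close>,
  so the product family is absolutely summable and may be summed row by row.\<close>

lemma has_sum_product:
  fixes f :: "'a \<Rightarrow> complex" and g :: "'b \<Rightarrow> complex"
  assumes f: "(f has_sum a) A" "(\<lambda>x. norm (f x)) summable_on A"
    and g: "(g has_sum b) B" "(\<lambda>x. norm (g x)) summable_on B"
  shows "((\<lambda>(x, y). f x * g y) has_sum a * b) (A \<times> B)"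
proof (rule has_sum_SigmaI)
  show "((\<lambda>y. case (x, y) of (x, y) \<Rightarrow> f x * g y) has_sum f x * b) B" for x
    using has_sum_cmult_right[OF g(1)] by simp
  show "((\<lambda>x. f x * b) has_sum a * b) A"
    by (rule has_sum_cmult_left[OF f(1)])
  have "(\<lambda>(x, y). norm (f x * g y)) summable_on A \<times> B"
  proof (rule summable_on_SigmaI)
    show "((\<lambda>y. case (x, y) of (x, y) \<Rightarrow> norm (f x * g y)) has_sum
        norm (f x) * infsum (\<lambda>y. norm (g y)) B) B" for x
      unfolding prod.case norm_mult by (rule has_sum_cmult_right[OF has_sum_infsum[OF g(2)]])
    show "(\<lambda>x. norm (f x) * infsum (\<lambda>y. norm (g y)) B) summable_on A"
      by (rule summable_on_cmult_left[OF f(2)])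
  qed auto
  then have "(\<lambda>z. norm ((\<lambda>(x, y). f x * g y) z)) summable_on A \<times> B"
    by (simp add: case_prod_unfold)
  then show "(\<lambda>(x, y). f x * g y) summable_on A \<times> B"
    by (rule abs_summable_summable)
qed


text \<open>In the product, x meets only m + n and y only m - n. In these two new indices the
  quadratic exponent of p has no mixed term, which is what separates the double series.\<close>

lemma jacobi_term_mult:
  assumes "p \<noteq> 0" "x \<noteq> 0" "y \<noteq> 0"
    and e: "m * (m - 1) + n * (n - 1) = 2 * e"
  shows "jacobi_term p (x * y) m * jacobi_term p (x / y) n = p powi e * (- x) powi (m + n) * y powi (m - n)"
proof -
  have "even (m * (m - 1))" "even (n * (n - 1))" by auto
  then obtain a b where ab: "m * (m - 1) = 2 * a" "n * (n - 1) = 2 * b" by (elim evenE)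
  have "jacobi_term p (x * y) m * jacobi_term p (x / y) n =
      (p powi a * p powi b) * (((- x) * y) powi m * ((- x) / y) powi n)"
    unfolding jacobi_term_def ab by simp
  also have "p powi a * p powi b = p powi e"
  proof -
    have "e = a + b" using e unfolding ab by simp
    then show ?thesis using assms(1) by (simp add: power_int_add)
  qed
  also have "((- x) * y) powi m * ((- x) / y) powi n = (- x) powi (m + n) * y powi (m - n)"
    using assms unfolding power_int_mult_distrib power_int_divide_distrib
    by (simp add: power_int_add power_int_diff)
  finally show ?thesis by (simp only: mult.assoc)
qed

text \<open>Together with \<open>jacobi_term_times_square\<close> this recognises the one-variable
  factors arising below as theta terms to the base p^2.\<close>

lemma jacobi_term_square:
  "jacobi_term (p\<^sup>2) (- x\<^sup>2) i = p powi (i * (i - 1)) * x powi (2 * i)"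
proof -
  have "even (i * (i - 1))" by auto
  then obtain a where a: "i * (i - 1) = 2 * a" by (elim evenE)
  show ?thesis unfolding jacobi_term_def a by (simp add: power_int_power)
qed

lemma jacobi_term_times_square:
  assumes "p \<noteq> 0"
  shows "jacobi_term (p\<^sup>2) (- (p * x\<^sup>2)) i = p powi (i * i) * x powi (2 * i)"
proof -
  have "even (i * (i - 1))" by auto
  then obtain a where a: "i * (i - 1) = 2 * a" by (elim evenE)
  have "i * i = 2 * a + i" using a by (simp add: algebra_simps)
  then show ?thesis
    using assms unfolding jacobi_term_def a
    by (simp add: power_int_power power_int_mult_distrib power_int_add)
qed

text \<open>For m = i + j and n = i - j the exponent of p is i(i-1) + j^2, so the product separates
  into a factor in i and a factor in j.\<close>

lemma jacobi_term_mult_even: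
  assumes "p \<noteq> 0" "x \<noteq> 0" "y \<noteq> 0"
  shows "jacobi_term p (x * y) (i + j) * jacobi_term p (x / y) (i - j) =
    jacobi_term (p\<^sup>2) (- x\<^sup>2) i * jacobi_term (p\<^sup>2) (- (p * y\<^sup>2)) j"
proof -
  have e: "(i + j) * (i + j - 1) + (i - j) * (i - j - 1) = 2 * (i * (i - 1) + j * j)" by algebra
  have "i + j + (i - j) = 2 * i" "i + j - (i - j) = 2 * j" by simp_all
  then show ?thesis
    unfolding jacobi_term_mult[OF assms e] jacobi_term_square jacobi_term_times_square[OF assms(1)]
    using assms by (simp add: power_int_add)
qed

text \<open>For m = i + j and n = i - j + 1 the exponent of p is i^2 + j(j-1), so the two types of
  series change roles. The odd numbers m + n = 2i + 1 and m - n = 2j - 1 leave the factor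
  -x/y.\<close>

lemma jacobi_term_mult_odd:
  assumes "p \<noteq> 0" "x \<noteq> 0" "y \<noteq> 0"
  shows "jacobi_term p (x * y) (i + j) * jacobi_term p (x / y) (i - j + 1) =
    - (x / y) * (jacobi_term (p\<^sup>2) (- (p * x\<^sup>2)) i * jacobi_term (p\<^sup>2) (- y\<^sup>2) j)"
proof -
  have e: "(i + j) * (i + j - 1) + (i - j + 1) * (i - j + 1 - 1) = 2 * (i * i + j * (j - 1))"
    by algebra
  have "i + j + (i - j + 1) = 2 * i + 1" "i + j - (i - j + 1) = 2 * j - 1" by simp_all
  moreover have "(- x) powi (2 * i + 1) = - x * x powi (2 * i)" "y powi (2 * j - 1) = y powi (2 * j) / y"
    using assms by (simp_all add: power_int_add power_int_diff)
  ultimately show ?thesis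
    unfolding jacobi_term_mult[OF assms e] jacobi_term_square jacobi_term_times_square[OF assms(1)]
    using assms by (simp add: power_int_add)
qed

text \<open>The double series for the two theta values is split by the parity of m + n. On each of
  the two pieces it separates into a product of two series, and these products are the two terms of
  the determinant.\<close>

lemma theta_mult_theta:
  assumes p: "norm p < 1" "p \<noteq> 0"
  obtains P Q where "\<And>x y. x \<noteq> 0 \<Longrightarrow> y \<noteq> 0 \<Longrightarrow>
    theta p (x * y) * theta p (x / y) = x * (Q x * P y - P x * Q y)"
proof -
  have p2: "norm (p\<^sup>2) < 1" "p\<^sup>2 \<noteq> 0"
    using p by (auto simp: norm_power power_less_one_iff)
  obtain L where L: "L \<noteq> 0" "\<And>x. x \<noteq> 0 \<Longrightarrow> (jacobi_term p x has_sum L * theta p x) UNIV"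
    using jacobi_triple_product[OF p] by metis
  obtain M where M: "M \<noteq> 0" "\<And>x. x \<noteq> 0 \<Longrightarrow> (jacobi_term (p\<^sup>2) x has_sum M * theta (p\<^sup>2) x) UNIV"
    using jacobi_triple_product[OF p2] by metis
  define P where "P x = M / L * theta (p\<^sup>2) (- (p * x\<^sup>2))" for x
  \<comment> \<open>The odd piece carries -x/y; dividing by the argument here makes the prefactor x
    common to both terms.\<close>
  define Q where "Q x = M / L * theta (p\<^sup>2) (- x\<^sup>2) / x" for x
  show ?thesis
  proof
    fix x y :: complex assume xy: "x \<noteq> 0" "y \<noteq> 0"
    let ?J = "\<lambda>(m, n). jacobi_term p (x * y) m * jacobi_term p (x / y) n"
    let ?even = "\<lambda>(i, j). (i + j, i - j) :: int \<times> int"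
    let ?odd = "\<lambda>(i, j). (i + j, i - j + 1) :: int \<times> int"
    have inj_even: "inj ?even" and inj_odd: "inj ?odd" by (auto simp: inj_on_def)
    have all: "(?J has_sum (L * theta p (x * y)) * (L * theta p (x / y))) (UNIV \<times> UNIV)"
      using xy p by (intro has_sum_product L jacobi_term_abs_summable) auto
    have "(?J has_sum
        (M * theta (p\<^sup>2) (- x\<^sup>2)) * (M * theta (p\<^sup>2) (- (p * y\<^sup>2))) +
        (- (x / y) * ((M * theta (p\<^sup>2) (- (p * x\<^sup>2))) * (M * theta (p\<^sup>2) (- y\<^sup>2)))))
        (range ?even \<union> range ?odd)"
    proof (rule has_sum_Un_disjoint)
      have "((\<lambda>(i, j). jacobi_term (p\<^sup>2) (- x\<^sup>2) i * jacobi_term (p\<^sup>2) (- (p * y\<^sup>2)) j) has_sum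
          (M * theta (p\<^sup>2) (- x\<^sup>2)) * (M * theta (p\<^sup>2) (- (p * y\<^sup>2)))) (UNIV \<times> UNIV)"
        using xy p p2 by (intro has_sum_product M jacobi_term_abs_summable) auto
      also have "(\<lambda>(i, j). jacobi_term (p\<^sup>2) (- x\<^sup>2) i * jacobi_term (p\<^sup>2) (- (p * y\<^sup>2)) j) = ?J \<circ> ?even"
        using jacobi_term_mult_even[OF p(2) xy] by (auto simp: fun_eq_iff)
      finally show "(?J has_sum (M * theta (p\<^sup>2) (- x\<^sup>2)) * (M * theta (p\<^sup>2) (- (p * y\<^sup>2)))) (range ?even)"
        unfolding has_sum_reindex[OF inj_even] UNIV_Times_UNIV .
      have "((\<lambda>z. - (x / y) * (case z of (i, j) \<Rightarrow>
            jacobi_term (p\<^sup>2) (- (p * x\<^sup>2)) i * jacobi_term (p\<^sup>2) (- y\<^sup>2) j)) has_sum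
          - (x / y) * ((M * theta (p\<^sup>2) (- (p * x\<^sup>2))) * (M * theta (p\<^sup>2) (- y\<^sup>2)))) (UNIV \<times> UNIV)"
        using xy p p2 by (intro has_sum_cmult_right has_sum_product M jacobi_term_abs_summable) auto
      also have "(\<lambda>z. - (x / y) * (case z of (i, j) \<Rightarrow>
            jacobi_term (p\<^sup>2) (- (p * x\<^sup>2)) i * jacobi_term (p\<^sup>2) (- y\<^sup>2) j)) = ?J \<circ> ?odd"
        using jacobi_term_mult_odd[OF p(2) xy] by (auto simp: fun_eq_iff)
      finally show "(?J has_sum - (x / y) * ((M * theta (p\<^sup>2) (- (p * x\<^sup>2))) * (M * theta (p\<^sup>2) (- y\<^sup>2))))
          (range ?odd)"
        unfolding has_sum_reindex[OF inj_odd] UNIV_Times_UNIV .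
      \<comment> \<open>The coordinates of an even point add up to 2i, those of an odd point to 2i +
        1.\<close>
      show "range ?even \<inter> range ?odd = {}"
      proof -
        have "?even z \<noteq> ?odd w" for z w :: "int \<times> int"
          by (cases z; cases w; simp; presburger)
        then show ?thesis by blast
      qed
    qed
    moreover have "range ?even \<union> range ?odd = UNIV \<times> UNIV"
    proof -
      have "(m, n) \<in> range ?even \<union> range ?odd" for m n
      proof (cases "even (m + n)")
        case True
        then have "(m, n) = ?even ((m + n) div 2, (m - n) div 2)" by (simp; presburger)
        then show ?thesis by blast
      next
        case False
        then have "(m, n) = ?odd ((m + n - 1) div 2, (m - n + 1) div 2)" by (simp; presburger)
        then show ?thesis by blast
      qed
      then show ?thesis by auto
    qed
    ultimately have "(L * theta p (x * y)) * (L * theta p (x / y)) =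
        (M * theta (p\<^sup>2) (- x\<^sup>2)) * (M * theta (p\<^sup>2) (- (p * y\<^sup>2))) +
        (- (x / y) * ((M * theta (p\<^sup>2) (- (p * x\<^sup>2))) * (M * theta (p\<^sup>2) (- y\<^sup>2))))"
      by (intro has_sum_unique[OF all]) simp
    then show "theta p (x * y) * theta p (x / y) = x * (Q x * P y - P x * Q y)"
      using xy L(1) unfolding P_def Q_def by (simp add: divide_simps) (simp add: algebra_simps)
  qed
qed

text \<open>Each product of four theta values becomes a prefactor times two 2 x 2 minors, and u/v
  brings the last prefactor to the common value xu. What remains is the Pluecker relation [xy][uv] -
  [xv][uy] + [vy][xu] = 0.\<close>

theorem weierstrass_three_term:
  assumes "norm p < 1" "p \<noteq> 0" "x \<noteq> 0" "y \<noteq> 0" "u \<noteq> 0" "v \<noteq> 0"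
  shows "theta p (x * y) * theta p (x / y) * (theta p (u * v) * theta p (u / v)) -
      theta p (x * v) * theta p (x / v) * (theta p (u * y) * theta p (u / y)) +
      u / v * (theta p (v * y) * theta p (v / y) * (theta p (x * u) * theta p (x / u))) = 0"
proof -
  obtain P Q where W: "\<And>x y. x \<noteq> 0 \<Longrightarrow> y \<noteq> 0 \<Longrightarrow>
    theta p (x * y) * theta p (x / y) = x * (Q x * P y - P x * Q y)"
    using theta_mult_theta[OF assms(1,2)] by metis
  have cancel: "u / v * (v * A * B) = u * A * B" for A B
    using assms by simp
  show ?thesis
    unfolding W[OF assms(3,4)] W[OF assms(5,6)] W[OF assms(3,6)] W[OF assms(5,4)]
      W[OF assms(6,4)] W[OF assms(3,5)] cancel by algebra
qed

subsection \<open>Theta values as products over residue classes\<close>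

text \<open>The two factors belonging to each k are exchanged.\<close>

lemma theta_flip:
  assumes "p \<noteq> 0"
  shows "theta p (p / x) = theta p x"
proof -
  have "(1 - p / x * p ^ k) * (1 - p ^ Suc k / (p / x)) = (1 - x * p ^ k) * (1 - p ^ Suc k / x)" for k
    using assms by (simp add: mult_ac)
  then show ?thesis unfolding theta_def by (simp only:)
qed

text \<open>Factor by factor this is (1 - z)(1 + z) = 1 - z^2, for z = x p^k and for z =
  p^(k+1)/x.\<close>

lemma theta_mult_theta_minus:
  assumes "norm p < 1"
  shows "theta p x * theta p (- x) = theta (p\<^sup>2) (x\<^sup>2)"
proof -
  have "((1 - x * p ^ k) * (1 - p ^ Suc k / x)) * ((1 - (- x) * p ^ k) * (1 - p ^ Suc k / (- x))) =
      (1 - x\<^sup>2 * (p\<^sup>2) ^ k) * (1 - (p\<^sup>2) ^ Suc k / x\<^sup>2)" for k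
  proof -
    define z y where "z = x * p ^ k" and "y = p ^ Suc k / x"
    have "(- x) * p ^ k = - z" "p ^ Suc k / (- x) = - y"
      unfolding z_def y_def by simp_all
    moreover have "x\<^sup>2 * (p\<^sup>2) ^ k = z\<^sup>2" "(p\<^sup>2) ^ Suc k / x\<^sup>2 = y\<^sup>2"
      unfolding z_def y_def by (simp_all only: power_mult_distrib power_divide power_mult[symmetric] mult.commute)
    moreover have "(1 - z) * (1 - y) * ((1 - - z) * (1 - - y)) = (1 - z\<^sup>2) * (1 - y\<^sup>2)"
      by algebra
    ultimately show ?thesis
      unfolding z_def[symmetric] y_def[symmetric] by (simp only:)
  qed
  then show ?thesis
    unfolding theta_def
    by (simp only: prodinf_mult convergent_prod_theta[OF assms])
qed

text \<open>Factor by factor this is (1 - z)(1 - zw)(1 - zw^2) = 1 - z^3. Since 1/w = w^2, the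
  arguments xw and x/w supply the two nontrivial roots, in exchanged order for the factors with
  p^(k+1)/x.\<close>

lemma theta_mult_theta_cube_roots:
  assumes "norm p < 1" and w: "1 + w + w\<^sup>2 = 0"
  shows "theta p x * (theta p (x * w) * theta p (x / w)) = theta (p ^ 3) (x ^ 3)"
proof -
  have w3: "w * (w * w) = 1" using w by algebra
  then have "w \<noteq> 0" by auto
  then have inv: "1 / w = w * w" using w3 by (simp add: field_simps)
  have cube: "(1 - z) * ((1 - z * w) * (1 - z * (w * w))) = 1 - z ^ 3" for z
    using w by algebra
  have "((1 - x * p ^ k) * (1 - p ^ Suc k / x)) *
      (((1 - x * w * p ^ k) * (1 - p ^ Suc k / (x * w))) * ((1 - x / w * p ^ k) * (1 - p ^ Suc k / (x / w)))) =
      (1 - x ^ 3 * (p ^ 3) ^ k) * (1 - (p ^ 3) ^ Suc k / x ^ 3)" for k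
  proof -
    define z y where "z = x * p ^ k" and "y = p ^ Suc k / x"
    have "x * w * p ^ k = z * w" "x / w * p ^ k = z * (w * w)"
      "p ^ Suc k / (x * w) = y * (w * w)" "p ^ Suc k / (x / w) = y * w"
      unfolding z_def y_def inv[symmetric] by (simp_all add: mult_ac)
    moreover have "x ^ 3 * (p ^ 3) ^ k = z ^ 3" "(p ^ 3) ^ Suc k / x ^ 3 = y ^ 3"
      unfolding z_def y_def by (simp_all only: power_mult_distrib power_divide power_mult[symmetric] mult.commute)
    moreover have "(1 - z) * (1 - y) * ((1 - z * w) * (1 - y * (w * w)) * ((1 - z * (w * w)) * (1 - y * w))) =
        (1 - z ^ 3) * (1 - y ^ 3)"
      unfolding cube[symmetric] by (simp only: mult_ac)
    ultimately show ?thesis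
      unfolding z_def[symmetric] y_def[symmetric] by (simp only:)
  qed
  then show ?thesis
    unfolding theta_def
    by (simp only: prodinf_mult convergent_prod_mult convergent_prod_theta[OF assms(1)])
qed

text \<open>The reciprocal of the generating function of partitions with parts in \<open>A\<close>.
  Trivial factors outside \<open>A\<close> give all sets the same index range; 0 as an element would
  make the product vanish.\<close>

definition parts_prod :: "complex \<Rightarrow> nat set \<Rightarrow> complex" where
  "parts_prod q A = (\<Prod>n. if n \<in> A then 1 - q ^ n else 1)"

lemma convergent_prod_parts:
  fixes q :: complex
  assumes "norm q < 1"
  shows "convergent_prod (\<lambda>n. if n \<in> A then 1 - q ^ n else 1)"
proof -
  have "summable (\<lambda>n. norm (if n \<in> A then q ^ n else 0))"
    by (rule summable_comparison_test'[OF summable_geometric[of "norm q"]])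
      (use assms in \<open>auto simp: norm_power\<close>)
  then have "convergent_prod (\<lambda>n. 1 - (if n \<in> A then q ^ n else 0))"
    by (rule convergent_prod_one_minus)
  also have "(\<lambda>n. 1 - (if n \<in> A then q ^ n else 0)) = (\<lambda>n. if n \<in> A then 1 - q ^ n else 1)"
    by auto
  finally show ?thesis .
qed

lemma parts_prod_LIMSEQ:
  assumes "norm q < 1"
  shows "(\<lambda>N. \<Prod>n<N. if n \<in> A then 1 - q ^ n else 1) \<longlonglongrightarrow> parts_prod q A"
  unfolding parts_prod_def by (rule prodinf_LIMSEQ[OF convergent_prod_parts[OF assms]])

lemma parts_prod_nonzero:
  assumes "norm q < 1" "0 \<notin> A"
  shows "parts_prod q A \<noteq> 0"
proof -
  have "n > 0" if "n \<in> A" for n using that assms(2) by (metis gr0I)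
  then show ?thesis
    unfolding parts_prod_def using one_minus_power_nonzero[OF assms(1)]
    by (intro prodinf_nonzero convergent_prod_parts assms(1)) simp
qed

lemma parts_prod_Un:
  assumes "norm q < 1" "A \<inter> B = {}"
  shows "parts_prod q (A \<union> B) = parts_prod q A * parts_prod q B"
proof -
  have "(if n \<in> A \<union> B then 1 - q ^ n else 1) =
      (if n \<in> A then 1 - q ^ n else 1) * (if n \<in> B then 1 - q ^ n else 1)" for n
    using assms(2) by auto
  then show ?thesis
    unfolding parts_prod_def by (simp only: prodinf_mult[OF convergent_prod_parts[OF assms(1)] convergent_prod_parts[OF assms(1)]])
qed

lemma parts_prod_residues:
  assumes "norm q < 1" "finite R"
  shows "parts_prod q {n. n mod m \<in> R} = (\<Prod>r\<in>R. parts_prod q {n. n mod m = r})"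
  using assms(2)
proof (induction R rule: finite_induct)
  case empty
  then show ?case by (simp add: parts_prod_def)
next
  case (insert r R)
  have "{n. n mod m \<in> insert r R} = {n. n mod m = r} \<union> {n. n mod m \<in> R}" by auto
  then show ?case using insert by (simp add: parts_prod_Un[OF assms(1)] disjoint_iff)
qed

lemma residue_class_refine:
  assumes "r < m" "c > 0"
  shows "{n. n mod m = r} = {n::nat. n mod (m * c) \<in> (\<lambda>i. r + m * i) ` {..<c}}"
proof (intro set_eqI iffI)
  fix n assume "n \<in> {n. n mod m = r}"
  then have "n mod (m * c) = r + m * (n div m mod c)"
    by (simp add: mod_mult2_eq add.commute)
  then show "n \<in> {n. n mod (m * c) \<in> (\<lambda>i. r + m * i) ` {..<c}}"
    using assms by auto
next
  fix n assume "n \<in> {n. n mod (m * c) \<in> (\<lambda>i. r + m * i) ` {..<c}}"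
  then obtain i where "n mod (m * c) = r + m * i" by auto
  then have "n mod (m * c) mod m = (r + m * i) mod m" by simp
  then show "n \<in> {n. n mod m = r}" using assms by (simp add: mod_mod_cancel)
qed

lemma parts_prod_residue_refine:
  assumes "norm q < 1" "r < m" "c > 0"
  shows "parts_prod q {n. n mod m = r} = (\<Prod>i<c. parts_prod q {n. n mod (m * c) = r + m * i})"
proof -
  have "inj_on (\<lambda>i. r + m * i) {..<c}" using assms(2) by (auto simp: inj_on_def)
  then show ?thesis
    unfolding residue_class_refine[OF assms(2,3)] parts_prod_residues[OF assms(1) finite_imageI[OF finite_lessThan]]
    by (simp add: prod.reindex)
qed

text \<open>The partial products are taken along the multiples of m: every block of m consecutive
  exponents meets the residue class exactly once.\<close>

lemma parts_prod_residue_LIMSEQ: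
  assumes "norm q < 1" "r < m"
  shows "(\<lambda>K. \<Prod>k<K. 1 - q ^ r * (q ^ m) ^ k) \<longlonglongrightarrow> parts_prod q {n. n mod m = r}"
proof -
  let ?f = "\<lambda>n. if n mod m = r then 1 - q ^ n else 1"
  have block: "(\<Prod>i<m. ?f (m * K + i)) = 1 - q ^ r * (q ^ m) ^ K" for K
  proof -
    have "(\<Prod>i<m. ?f (m * K + i)) = (\<Prod>i<m. if i = r then 1 - q ^ (m * K + r) else 1)"
      by (intro prod.cong) auto
    then show ?thesis using assms(2) by (simp add: power_add power_mult mult.commute[of "q ^ r"])
  qed
  have partial: "(\<Prod>n<m * K. ?f n) = (\<Prod>k<K. 1 - q ^ r * (q ^ m) ^ k)" for K
  proof (induction K)
    case (Suc K)
    have "(\<Prod>n<m * Suc K. ?f n) = (\<Prod>n<m * K. ?f n) * (\<Prod>i<m. ?f (m * K + i))"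
      unfolding mult_Suc_right add.commute[of m] by (rule prod_lessThan_add)
    then show ?case by (simp only: Suc block prod.lessThan_Suc)
  qed simp
  have "filterlim (\<lambda>K. m * K) sequentially sequentially"
    using assms(2) by (intro mult_nat_left_at_top) simp
  from filterlim_compose[OF parts_prod_LIMSEQ[OF assms(1), of "{n. n mod m = r}"] this]
  show ?thesis by (simp add: partial)
qed

text \<open>The two families of factors run through the exponents r + mk and (m - r) + mk. For m =
  2r these are the same class, and the value is a square.\<close>

lemma theta_power_eq_parts_prod:
  assumes "norm q < 1" "q \<noteq> 0" "0 < r" "r < m"
  shows "theta (q ^ m) (q ^ r) = parts_prod q {n. n mod m = r} * parts_prod q {n. n mod m = m - r}"
proof (rule LIMSEQ_unique)
  have "norm (q ^ m) < 1" using assms by (simp add: norm_power power_less_one_iff)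
  from theta_LIMSEQ[OF this]
  show "(\<lambda>n. \<Prod>k<n. (1 - q ^ r * (q ^ m) ^ k) * (1 - (q ^ m) ^ Suc k / q ^ r)) \<longlonglongrightarrow> theta (q ^ m) (q ^ r)" .
  have "(q ^ m) ^ Suc k / q ^ r = q ^ (m - r) * (q ^ m) ^ k" for k
    using assms by (simp add: power_diff)
  moreover have "m - r < m" using assms by simp
  ultimately show "(\<lambda>n. \<Prod>k<n. (1 - q ^ r * (q ^ m) ^ k) * (1 - (q ^ m) ^ Suc k / q ^ r)) \<longlonglongrightarrow>
      parts_prod q {n. n mod m = r} * parts_prod q {n. n mod m = m - r}"
    using assms by (simp only: prod.distrib) (intro tendsto_mult parts_prod_residue_LIMSEQ; simp)
qed

subsection \<open>Generating functions of partitions\<close>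

abbreviation partitions_into :: "nat set \<Rightarrow> nat \<Rightarrow> nat multiset set" where
  "partitions_into A n \<equiv> {P. set_mset P \<subseteq> A \<and> sum_mset P = n}"

text \<open>A partition containing \<open>a\<close> loses one copy of it; the rest may contain
  \<open>a\<close> again, so the larger set of parts recurs.\<close>

lemma partitions_into_insert:
  assumes "a \<notin> A"
  shows "partitions_into (insert a A) n =
    partitions_into A n \<union> (if a \<le> n then add_mset a ` partitions_into (insert a A) (n - a) else {})"
    (is "?L = ?R")
proof
  show "?L \<subseteq> ?R"
  proof
    fix P assume P: "P \<in> ?L"
    show "P \<in> ?R"
    proof (cases "a \<in># P")
      case True
      then obtain P' where "P = add_mset a P'" by (meson multi_member_split)
      then show ?thesis using P by auto
    next
      case False
      then show ?thesis using P by auto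
    qed
  qed
  show "?R \<subseteq> ?L" by auto
qed

lemma partitions_into_lessThan:
  assumes "n < N"
  shows "partitions_into (A \<inter> {..<N}) n = partitions_into A n"
proof -
  have "k < N" if "k \<in># P" "sum_mset P = n" for k P
    using that assms by (metis le_add1 le_less_trans multi_member_split sum_mset.add_mset)
  then show ?thesis by auto
qed

text \<open>No part exceeds n, so finitely many part sizes suffice. For these, induction on the set
  is combined with induction on n: removing a copy of b keeps the set but lowers the sum.\<close>

lemma finite_partitions_into:
  assumes "0 \<notin> A"
  shows "finite (partitions_into A n)"
proof -
  have fin: "finite (partitions_into B n)" if "finite B" "0 \<notin> B" for B n
    using that
  proof (induction B arbitrary: n rule: finite_induct)
    case empty
    have "partitions_into {} n \<subseteq> {{#}}" by auto
    then show ?case by (rule finite_subset) simp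
  next
    case (insert b B)
    show ?case
    proof (induction n rule: less_induct)
      case (less n)
      have "b > 0" using insert.prems by auto
      then have "finite (partitions_into (insert b B) (n - b))" if "b \<le> n"
        using that by (intro less) auto
      then show ?case
        unfolding partitions_into_insert[OF insert.hyps(2), of n] using insert.IH insert.prems by auto
    qed
  qed
  have "finite (partitions_into (A \<inter> {..<Suc n}) n)" by (rule fin) (use assms in auto)
  then show ?thesis unfolding partitions_into_lessThan[OF lessI] .
qed

text \<open>In terms of generating functions, admitting the part \<open>a\<close> divides by 1 -
  q^a.\<close>

lemma partition_count_insert:
  assumes "a \<notin> A" "0 \<notin> insert a A"
  shows "partition_count (insert a A) n =
    partition_count A n + (if a \<le> n then partition_count (insert a A) (n - a) else 0)"
proof -
  have "partitions_into A n \<inter> (add_mset a ` X) = {}" for X using assms by auto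
  then have "card (partitions_into (insert a A) n) = card (partitions_into A n) +
      card (if a \<le> n then add_mset a ` partitions_into (insert a A) (n - a) else {})"
    unfolding partitions_into_insert[OF assms(1), of n] using assms
    by (intro card_Un_disjoint) (auto intro: finite_partitions_into)
  then show ?thesis
    by (simp add: partition_count_def card_image inj_on_def split: if_splits)
qed

lemma partition_count_lessThan: "n < N \<Longrightarrow> partition_count (A \<inter> {..<N}) n = partition_count A n"
  unfolding partition_count_def by (simp only: partitions_into_lessThan)

lemma partition_count_mono:
  assumes "A \<subseteq> B" "0 \<notin> B"
  shows "partition_count A n \<le> partition_count B n"
  unfolding partition_count_def by (rule card_mono[OF finite_partitions_into]) (use assms in auto)

lemma partition_count_empty: "partition_count {} n = (if n = 0 then 1 else 0)"
proof -
  have "partitions_into {} n = (if n = 0 then {{#}} else {})" by auto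
  then show ?thesis by (simp add: partition_count_def)
qed

text \<open>Induction over the parts. The recurrence determines the new sum only once its
  convergence is known, so summability is established first, at the radius |q|.\<close>

lemma partition_count_sums_finite:
  fixes q :: complex
  assumes "finite A" "0 \<notin> A" "norm q < 1"
  shows "summable (\<lambda>n. real (partition_count A n) * norm q ^ n)"
    and "(\<lambda>n. of_nat (partition_count A n) * q ^ n) sums (1 / (\<Prod>a\<in>A. 1 - q ^ a))"
proof -
  have "summable (\<lambda>n. real (partition_count A n) * norm q ^ n) \<and>
      (\<lambda>n. of_nat (partition_count A n) * q ^ n) sums (1 / (\<Prod>a\<in>A. 1 - q ^ a))"
    using assms(1,2)
  proof (induction A rule: finite_induct)
    case empty
    have "(\<lambda>n. of_nat (partition_count {} n) * q ^ n) = (\<lambda>n. if n = 0 then 1 else 0)"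
      by (auto simp: partition_count_empty)
    moreover have "(\<lambda>n. real (partition_count {} n) * norm q ^ n) = (\<lambda>n. if n = 0 then 1 else 0)"
      by (auto simp: partition_count_empty)
    ultimately show ?case
      using sums_single[of 0 "\<lambda>_. 1 :: complex"] sums_single[of 0 "\<lambda>_. 1 :: real"]
      by (auto simp: sums_iff)
  next
    case (insert a A)
    define f g where "f n = real (partition_count A n)" and "g n = real (partition_count (insert a A) n)" for n
    have a: "a > 0" using insert.prems by auto
    have IH: "summable (\<lambda>n. f n * norm q ^ n)"
      "(\<lambda>n. of_real (f n) * q ^ n) sums (1 / (\<Prod>a\<in>A. 1 - q ^ a))"
      using insert by (auto simp: f_def)
    have rec: "g n = f n + (if a \<le> n then g (n - a) else 0)" for n
      using partition_count_insert[OF insert.hyps(2) insert.prems, of n] by (simp add: f_def g_def)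
    have nonneg: "f n \<ge> 0" "g n \<ge> 0" for n by (auto simp: f_def g_def)
    define r where "r = norm q"
    have r: "0 \<le> r" "r < 1" "r ^ a < 1" using assms(3) a by (auto simp: r_def power_less_one_iff)
    have shift: "(\<Sum>n<N. (if a \<le> n then g (n - a) else 0) * r ^ n) \<le> r ^ a * (\<Sum>n<N. g n * r ^ n)" for N
    proof -
      have "(\<Sum>n<N. (if a \<le> n then g (n - a) else 0) * r ^ n) = (\<Sum>n\<in>{a..<N}. g (n - a) * r ^ n)"
        by (rule sum.mono_neutral_cong_right) auto
      also have "\<dots> = (\<Sum>n<N - a. r ^ a * (g n * r ^ n))"
        by (rule sum.reindex_bij_witness[of _ "\<lambda>n. n + a" "\<lambda>n. n - a"])
          (auto simp flip: power_add)
      also have "\<dots> \<le> (\<Sum>n<N. r ^ a * (g n * r ^ n))"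
        using r nonneg by (intro sum_mono2) auto
      finally show ?thesis by (simp add: sum_distrib_left)
    qed
    \<comment> \<open>With G the new partial sum and F the full old series, the recurrence gives G
      \<le> F + r^a G, which is solved for G.\<close>
    have bound: "(\<Sum>n<N. g n * r ^ n) \<le> (\<Sum>n. f n * r ^ n) / (1 - r ^ a)" for N
    proof -
      have "(\<Sum>n<N. g n * r ^ n) = (\<Sum>n<N. f n * r ^ n) + (\<Sum>n<N. (if a \<le> n then g (n - a) else 0) * r ^ n)"
        by (subst rec) (simp only: distrib_right sum.distrib)
      also have "\<dots> \<le> (\<Sum>n. f n * r ^ n) + r ^ a * (\<Sum>n<N. g n * r ^ n)"
        using IH(1) nonneg r by (intro add_mono shift sum_le_suminf) (auto simp: r_def)
      finally show ?thesis using r by (simp add: field_simps)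
    qed
    have summable_g: "summable (\<lambda>n. g n * r ^ n)"
      by (rule summableI_nonneg_bounded[OF _ bound]) (use nonneg r in auto)
    have "summable (\<lambda>n. of_real (g n) * q ^ n)"
      by (rule summable_norm_cancel) (use summable_g nonneg in \<open>simp add: norm_mult norm_power r_def\<close>)
    then obtain G where G: "(\<lambda>n. of_real (g n) * q ^ n) sums G" by (auto simp: summable_def)
    have "(\<lambda>n. of_real (if a \<le> n then g (n - a) else 0) * q ^ n) sums (q ^ a * G)"
    proof (rule sums_zero_iff_shift[THEN iffD1])
      show "of_real (if a \<le> n then g (n - a) else 0) * q ^ n = 0" if "n < a" for n
        using that by simp
      show "(\<lambda>n. of_real (if a \<le> n + a then g (n + a - a) else 0) * q ^ (n + a)) sums (q ^ a * G)"
        using sums_mult[OF G, of "q ^ a"] by (simp add: power_add mult_ac)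
    qed
    from sums_add[OF IH(2) this]
    have "(\<lambda>n. of_real (g n) * q ^ n) sums (1 / (\<Prod>a\<in>A. 1 - q ^ a) + q ^ a * G)"
      by (subst rec) (simp add: distrib_right)
    with G have "G = 1 / (\<Prod>a\<in>A. 1 - q ^ a) + q ^ a * G" by (rule sums_unique2)
    then have "(1 - q ^ a) * G = 1 / (\<Prod>a\<in>A. 1 - q ^ a)" by (simp add: algebra_simps)
    moreover have "1 - q ^ a \<noteq> 0" using one_minus_power_nonzero[OF assms(3) a] .
    ultimately have "G = 1 / (\<Prod>a\<in>A. 1 - q ^ a) / (1 - q ^ a)" by (metis nonzero_mult_div_cancel_left)
    then have "G = 1 / (\<Prod>a\<in>insert a A. 1 - q ^ a)" using insert.hyps by simp
    then show ?case using G summable_g by (simp add: g_def r_def)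
  qed
  then show "summable (\<lambda>n. real (partition_count A n) * norm q ^ n)"
    "(\<lambda>n. of_nat (partition_count A n) * q ^ n) sums (1 / (\<Prod>a\<in>A. 1 - q ^ a))" by auto
qed

text \<open>The set of parts is cut off at N. Each coefficient is eventually constant in N and the
  series of \<open>A\<close> at |q| dominates, so the limit of the finite identities may be taken on
  both sides.\<close>

lemma partition_count_sums:
  fixes q :: complex
  assumes "0 \<notin> A" "norm q < 1"
  shows "(\<lambda>n. of_nat (partition_count A n) * q ^ n) sums (1 / parts_prod q A)"
proof -
  define B where "B N = A \<inter> {..<N}" for N
  have B: "finite (B N)" "0 \<notin> B N" for N using assms by (auto simp: B_def)
  have prod_B: "(\<Prod>a\<in>B N. 1 - z ^ a) = (\<Prod>n<N. if n \<in> A then 1 - z ^ n else 1)" for N and z :: complex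
    unfolding B_def Int_commute[of A] by (rule prod.inter_restrict) simp
  have inv_lim: "(\<lambda>N. 1 / (\<Prod>a\<in>B N. 1 - z ^ a)) \<longlonglongrightarrow> 1 / parts_prod z A" if "norm z < 1" for z
    unfolding prod_B using that assms
    by (intro tendsto_divide tendsto_const parts_prod_LIMSEQ parts_prod_nonzero)
  define r where "r = norm q"
  have r: "0 \<le> r" "r < 1" "norm (complex_of_real r) < 1" using assms by (auto simp: r_def)
  \<comment> \<open>At the real point r the reciprocal products converge, hence are bounded; this
    bounds all truncated series at once and so makes the dominating series converge.\<close>
  have "Bseq (\<lambda>N. 1 / (\<Prod>a\<in>B N. 1 - complex_of_real r ^ a))"
    using inv_lim[OF r(3)] by (metis convergentI convergent_imp_Bseq)
  then obtain K where K: "\<And>N. norm (1 / (\<Prod>a\<in>B N. 1 - complex_of_real r ^ a)) \<le> K"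
    by (auto simp: Bseq_def)
  have "summable (\<lambda>n. real (partition_count A n) * r ^ n)"
  proof (rule summableI_nonneg_bounded)
    fix N
    \<comment> \<open>For n < N the truncation does not change the count.\<close>
    have "(\<Sum>n<N. real (partition_count A n) * r ^ n) = (\<Sum>n<N. real (partition_count (B N) n) * r ^ n)"
      by (simp add: B_def partition_count_lessThan)
    also have "\<dots> \<le> (\<Sum>n. real (partition_count (B N) n) * r ^ n)"
      using partition_count_sums_finite(1)[OF B assms(2)] r by (intro sum_le_suminf) (auto simp: r_def)
    also have "\<dots> \<le> norm (complex_of_real (\<Sum>n. real (partition_count (B N) n) * r ^ n))"
      by simp
    also have "complex_of_real (\<Sum>n. real (partition_count (B N) n) * r ^ n) =
        1 / (\<Prod>a\<in>B N. 1 - complex_of_real r ^ a)"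
    proof (rule sums_unique2)
      show "(\<lambda>n. of_nat (partition_count (B N) n) * complex_of_real r ^ n) sums
          (1 / (\<Prod>a\<in>B N. 1 - complex_of_real r ^ a))"
        by (rule partition_count_sums_finite(2)[OF B r(3)])
      show "(\<lambda>n. of_nat (partition_count (B N) n) * complex_of_real r ^ n) sums
          complex_of_real (\<Sum>n. real (partition_count (B N) n) * r ^ n)"
        using sums_of_real[OF summable_sums[OF partition_count_sums_finite(1)[OF B assms(2)]]]
        by (simp add: r_def)
    qed
    finally show "(\<Sum>n<N. real (partition_count A n) * r ^ n) \<le> K" using K[of N] by simp
  qed (use r in auto)
  then have dom: "(\<lambda>n. real (partition_count A n) * r ^ n) summable_on UNIV"
    using r by (intro summable_nonneg_imp_summable_on) auto
  have lim: "(\<lambda>N. of_nat (partition_count (B N) n) * q ^ n) \<longlonglongrightarrow> of_nat (partition_count A n) * q ^ n" for n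
    by (rule tendsto_eventually)
      (auto simp: eventually_sequentially B_def partition_count_lessThan intro!: exI[of _ "Suc n"])
  have bound: "norm (of_nat (partition_count (B N) n) * q ^ n) \<le> real (partition_count A n) * r ^ n" for N n
    using partition_count_mono[of "B N" A n] assms(1)
    by (auto simp: norm_mult norm_power r_def B_def intro!: mult_right_mono)
  have abs: "(\<lambda>n. norm (of_nat (partition_count A n) * q ^ n)) summable_on UNIV"
    by (rule infsum_dominated_convergence(2)[OF dom lim bound])
  have "(\<lambda>N. infsum (\<lambda>n. of_nat (partition_count (B N) n) * q ^ n) UNIV) \<longlonglongrightarrow>
      infsum (\<lambda>n. of_nat (partition_count A n) * q ^ n) UNIV"
    by (rule infsum_dominated_convergence(1)[OF dom lim bound])
  moreover have "infsum (\<lambda>n. of_nat (partition_count (B N) n) * q ^ n) UNIV = 1 / (\<Prod>a\<in>B N. 1 - q ^ a)" for N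
    using partition_count_sums_finite[OF B assms(2), of N]
    by (intro infsumI norm_summable_imp_has_sum) (auto simp: norm_mult norm_power)
  ultimately have "infsum (\<lambda>n. of_nat (partition_count A n) * q ^ n) UNIV = 1 / parts_prod q A"
    using LIMSEQ_unique[OF _ inv_lim[OF assms(2)]] by simp
  then show ?thesis
    using has_sum_imp_sums[OF has_sum_infsum[OF abs_summable_summable[OF abs]]] by simp
qed

subsection \<open>The identity modulo 72\<close>

lemma theta_power_refine:
  assumes "norm q < 1" "q \<noteq> 0" "0 < r" "r < m" "c > 0"
  shows "theta (q ^ m) (q ^ r) = (\<Prod>i<c. parts_prod q {n. n mod (m * c) = r + m * i} *
      parts_prod q {n. n mod (m * c) = m - r + m * i})"
  using assms by (simp add: theta_power_eq_parts_prod parts_prod_residue_refine[of q _ m c] prod.distrib)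

lemma primitive_cube_root_unity: "\<exists>w::complex. 1 + w + w\<^sup>2 = 0"
  by (rule exI[of _ "Complex (- 1 / 2) (sqrt 3 / 2)"])
    (simp add: complex_eq_iff power2_eq_square)

text \<open>Both denominators split into blocks of residues that are tied to theta values. Clearing
  denominators leaves \<open>a * o2 - q * b * o1\<close>, which the three-term relation
  evaluates.\<close>

lemma product_identity_72:
  fixes q :: complex
  assumes q: "norm q < 1" "q \<noteq> 0"
  shows "1 / parts_prod q {n. n mod 72 \<in>
      {1, 3, 5, 7, 8, 9, 10, 11, 12, 13, 14, 16, 17, 18, 19, 23, 25, 27, 29, 31, 32, 33, 34, 35,
      71, 69, 67, 65, 64, 63, 62, 61, 60, 59, 58, 56, 55, 54, 53, 49, 47, 45, 43, 41, 40, 39, 38, 37}} -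
    q / parts_prod q {n. n mod 72 \<in>
      {1, 2, 5, 7, 8, 9, 11, 12, 13, 15, 16, 17, 18, 19, 21, 22, 23, 25, 26, 27, 29, 31, 32, 35,
      71, 70, 67, 65, 64, 63, 61, 60, 59, 57, 56, 55, 54, 53, 51, 50, 49, 47, 46, 45, 43, 41, 40, 37}} = 1"
proof -
  define e where "e r = parts_prod q {n. n mod 72 = r}" for r
  have e_nz: "e r \<noteq> 0" if "r > 0" for r
    unfolding e_def using q(1) that by (intro parts_prod_nonzero) auto
  have th: "theta (q ^ m) (q ^ r) = (\<Prod>i<c. e (r + m * i) * e (m - r + m * i))"
    if "0 < r" "r < m" "m * c = 72" for m r c
  proof -
    have "c > 0" using that by (cases c) auto
    from theta_power_refine[OF q that(1,2) this] show ?thesis unfolding e_def that(3) .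
  qed
  \<comment> \<open>The blocks are classes to smaller moduli: \<open>a\<close>, \<open>b\<close>,
    \<open>x4\<close>, \<open>x8\<close> are +-2, +-10, +-4, +-8 mod 24; \<open>o1\<close>,
    \<open>o2\<close>, \<open>s6\<close> are +-3, +-15, +-6 mod 36; \<open>o3\<close> is 9 mod 18,
    \<open>s18\<close> is 18 mod 36, \<open>t12\<close> is +-12 mod 72, and \<open>u\<close>
    collects the residues prime to 6. The two denominators differ only in \<open>b\<close>,
    \<open>o1\<close> against \<open>a\<close>, \<open>o2\<close>.\<close>
  define a where "a = e 2 * e 22 * e 26 * e 46 * e 50 * e 70"
  define b where "b = e 10 * e 14 * e 34 * e 38 * e 58 * e 62"
  define o1 where "o1 = e 3 * e 33 * e 39 * e 69"
  define o2 where "o2 = e 15 * e 21 * e 51 * e 57"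
  define o3 where "o3 = e 9 * e 27 * e 45 * e 63"
  define x4 where "x4 = e 4 * e 20 * e 28 * e 44 * e 52 * e 68"
  define x8 where "x8 = e 8 * e 16 * e 32 * e 40 * e 56 * e 64"
  define s6 where "s6 = e 6 * e 30 * e 42 * e 66"
  define s18 where "s18 = e 18 * e 54"
  define t12 where "t12 = e 12 * e 60"
  define u where "u = e 1 * e 5 * e 7 * e 11 * e 13 * e 17 * e 19 * e 23 * e 25 * e 29 * e 31 *
      e 35 * e 37 * e 41 * e 43 * e 47 * e 49 * e 53 * e 55 * e 59 * e 61 * e 65 * e 67 * e 71"
  note defs = a_def b_def o1_def o2_def o3_def x4_def x8_def s6_def s18_def t12_def u_def
  have nz: "a \<noteq> 0" "b \<noteq> 0" "o1 \<noteq> 0" "o2 \<noteq> 0" "o3 \<noteq> 0" "x4 \<noteq> 0" "x8 \<noteq> 0" "s6 \<noteq> 0" "s18 \<noteq> 0" "t12 \<noteq> 0" "u \<noteq> 0"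
    unfolding defs by (simp_all add: e_nz)
  have t24_2: "theta (q ^ 24) (q ^ 2) = a"
    unfolding defs th[of 2 24 3, simplified]
    by (simp add: lessThan_nat_numeral lessThan_Suc mult_ac power2_eq_square numeral_2_eq_2[symmetric])
  have t24_10: "theta (q ^ 24) (q ^ 10) = b"
    unfolding defs th[of 10 24 3, simplified]
    by (simp add: lessThan_nat_numeral lessThan_Suc mult_ac power2_eq_square numeral_2_eq_2[symmetric])
  have t36_15: "theta (q ^ 36) (q ^ 15) = o2"
    unfolding defs th[of 15 36 2, simplified]
    by (simp add: lessThan_nat_numeral lessThan_Suc mult_ac power2_eq_square numeral_2_eq_2[symmetric])
  have t36_3: "theta (q ^ 36) (q ^ 3) = o1"
    unfolding defs th[of 3 36 2, simplified]
    by (simp add: lessThan_nat_numeral lessThan_Suc mult_ac power2_eq_square numeral_2_eq_2[symmetric])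
  have t24_6: "theta (q ^ 24) (q ^ 6) = s6 * s18"
    unfolding defs th[of 6 24 3, simplified]
    by (simp add: lessThan_nat_numeral lessThan_Suc mult_ac power2_eq_square numeral_2_eq_2[symmetric])
  have t12_3: "theta (q ^ 12) (q ^ 3) = o1 * (o2 * o3)"
    unfolding defs th[of 3 12 6, simplified]
    by (simp add: lessThan_nat_numeral lessThan_Suc mult_ac power2_eq_square numeral_2_eq_2[symmetric])
  have t24_4: "theta (q ^ 24) (q ^ 4) = x4"
    unfolding defs th[of 4 24 3, simplified]
    by (simp add: lessThan_nat_numeral lessThan_Suc mult_ac power2_eq_square numeral_2_eq_2[symmetric])
  have t12_2: "theta (q ^ 12) (q ^ 2) = a * b"
    unfolding defs th[of 2 12 6, simplified]
    by (simp add: lessThan_nat_numeral lessThan_Suc mult_ac power2_eq_square numeral_2_eq_2[symmetric])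
  have t36_6: "theta (q ^ 36) (q ^ 6) = s6"
    unfolding defs th[of 6 36 2, simplified]
    by (simp add: lessThan_nat_numeral lessThan_Suc mult_ac power2_eq_square numeral_2_eq_2[symmetric])
  have t72_12: "theta (q ^ 72) (q ^ 12) = t12"
    unfolding defs th[of 12 72 1, simplified]
    by (simp add: lessThan_nat_numeral lessThan_Suc mult_ac power2_eq_square numeral_2_eq_2[symmetric])
  \<comment> \<open>As 12 - 6 = 6, both families of factors run over the same class, whence the
    square.\<close>
  have t12_6: "theta (q ^ 12) (q ^ 6) = (s6 * s18)\<^sup>2"
    unfolding defs th[of 6 12 6, simplified]
    by (simp add: lessThan_nat_numeral lessThan_Suc mult_ac power2_eq_square numeral_2_eq_2[symmetric])
  have t12_4: "theta (q ^ 12) (q ^ 4) = x4 * x8"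
    unfolding defs th[of 4 12 6, simplified]
    by (simp add: lessThan_nat_numeral lessThan_Suc mult_ac power2_eq_square numeral_2_eq_2[symmetric])
  \<comment> \<open>The residues 1, 11 and 5, 7 modulo 12 make up all residues prime to 6.\<close>
  have t15: "theta (q ^ 12) q * theta (q ^ 12) (q ^ 5) = u"
    using th[of 1 12 6] th[of 5 12 6] unfolding defs
    by (simp add: lessThan_nat_numeral lessThan_Suc mult_ac numeral_2_eq_2[symmetric])
  obtain w :: complex where w: "1 + w + w\<^sup>2 = 0" using primitive_cube_root_unity by blast
  then have "w \<noteq> 0" by auto
  have p: "norm (q ^ m) < 1" "q ^ m \<noteq> 0" if "m > 0" for m
    using q that by (auto simp: norm_power power_less_one_iff)
  let ?t = "theta (q ^ 12)"
  have double: "theta (q ^ m) (q ^ k) * theta (q ^ m) (- (q ^ k)) = theta (q ^ (2 * m)) (q ^ (2 * k))"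
    if "m > 0" for m k
    using theta_mult_theta_minus[OF p(1)[OF that]] by (simp add: power_even_eq)
  have triple: "?t x * (?t (x * w) * ?t (x / w)) = theta (q ^ 36) (x ^ 3)" for x
    using theta_mult_theta_cube_roots[OF p(1) w, of 12] by (simp flip: power_mult)
  have d1: "?t q * ?t (- q) = a" using double[of 12 1] t24_2 by simp
  have d5: "?t (q ^ 5) * ?t (- (q ^ 5)) = b" using double[of 12 5] t24_10 by simp
  have d3: "?t (q ^ 3) * ?t (- (q ^ 3)) = s6 * s18" using double[of 12 3] t24_6 by simp
  have d2: "?t (q ^ 2) * ?t (- (q ^ 2)) = x4" using double[of 12 2] t24_4 by simp
  have d6: "theta (q ^ 36) (q ^ 6) * theta (q ^ 36) (- (q ^ 6)) = t12" using double[of 36 6] t72_12 by simp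
  have c1: "?t q * (?t (q * w) * ?t (q / w)) = o1" using triple[of q] t36_3 by simp
  have c5: "?t (q ^ 5) * (?t (q ^ 5 * w) * ?t (q ^ 5 / w)) = o2"
    using triple[of "q ^ 5"] t36_15 by (simp flip: power_mult)
  have c2: "?t (- (q ^ 2)) * (?t (- (q ^ 2) * w) * ?t (- (q ^ 2) / w)) = theta (q ^ 36) (- (q ^ 6))"
    using triple[of "- (q ^ 2)"] by (simp flip: power_mult)
  \<comment> \<open>The three-term relation produces the argument -q^7, the product of q^5 and -q^2;
    inversion moves it to -q^5.\<close>
  have flip: "?t (- (q ^ 7)) = ?t (- (q ^ 5))"
  proof -
    have "q ^ 12 / (- (q ^ 5)) = - (q ^ 7)" using q(2) by (simp add: power_diff[symmetric] flip: minus_divide_right)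
    then show ?thesis using theta_flip[OF p(2), of 12 "- (q ^ 5)"] by simp
  qed
  \<comment> \<open>The points are x = q^5, y = w, u = -q^2, v = q; the coefficient -q is
    u/v.\<close>
  have three_term: "?t (q ^ 5 * w) * ?t (q ^ 5 / w) * (?t (- (q ^ 3)) * ?t (- q)) -
      ?t (q ^ 6) * ?t (q ^ 4) * (?t (- (q ^ 2) * w) * ?t (- (q ^ 2) / w)) -
      q * (?t (q * w) * ?t (q / w) * (?t (- (q ^ 5)) * ?t (- (q ^ 3)))) = 0"
  proof -
    have "q ^ 5 * q = q ^ 6" "q ^ 5 / q = q ^ 4" "- (q ^ 2) * q = - (q ^ 3)" "- (q ^ 2) / q = - q"
      "q ^ 5 * - (q ^ 2) = - (q ^ 7)" "q ^ 5 / - (q ^ 2) = - (q ^ 3)"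
      using q(2) by (simp_all add: eval_nat_numeral)
    then show ?thesis
      using weierstrass_three_term[OF p[of 12], of "q ^ 5" w "- (q ^ 2)" q] q(2) \<open>w \<noteq> 0\<close> flip
      by simp
  qed
  define C D N where "C = ?t (q ^ 5 * w) * ?t (q ^ 5 / w)" and "D = ?t (q * w) * ?t (q / w)"
    and "N = ?t (- (q ^ 2) * w) * ?t (- (q ^ 2) / w)"
  \<comment> \<open>\<open>N\<close> lacks the theta value at -q^2 to be a full cube-root product,
    and the resulting value at -q^6 to the base q^36 lacks its partner at q^6. The factors
    \<open>x4\<close> and \<open>s6\<close> supply both.\<close>
  have N: "s6 * x4 * N = t12 * a * b"
  proof -
    have "s6 * x4 * N = s6 * ?t (q ^ 2) * (?t (- (q ^ 2)) * N)" unfolding d2[symmetric] by (simp only: mult_ac)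
    also have "\<dots> = (a * b) * (theta (q ^ 36) (q ^ 6) * theta (q ^ 36) (- (q ^ 6)))"
      unfolding N_def c2 t12_2 t36_6 by (simp only: mult_ac)
    finally show ?thesis unfolding d6 by (simp only: mult_ac)
  qed
  \<comment> \<open>The factor \<open>s6 * s18\<close> contains the theta value at -q^3, which the
    first and last terms of the three-term relation share.\<close>
  have "s6 * s18 * (a * o2 - q * b * o1) = (?t (q ^ 3) * ?t (- (q ^ 3))) *
      ((?t q * ?t (- q)) * (?t (q ^ 5) * C) - q * (?t (q ^ 5) * ?t (- (q ^ 5))) * (?t q * D))"
    unfolding C_def D_def d1 d5 d3 c1 c5 ..
  also have "\<dots> = ?t (q ^ 3) * (?t q * ?t (q ^ 5)) *
      (C * (?t (- (q ^ 3)) * ?t (- q)) - q * (D * (?t (- (q ^ 5)) * ?t (- (q ^ 3)))))"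
    by (simp add: algebra_simps)
  also have "C * (?t (- (q ^ 3)) * ?t (- q)) - q * (D * (?t (- (q ^ 5)) * ?t (- (q ^ 3)))) = ?t (q ^ 6) * ?t (q ^ 4) * N"
    using three_term unfolding C_def D_def N_def by (simp add: algebra_simps)
  also have "?t (q ^ 3) * (?t q * ?t (q ^ 5)) * (?t (q ^ 6) * ?t (q ^ 4) * N) =
      o1 * (o2 * o3) * u * (s6 * s18\<^sup>2 * x8) * (s6 * x4 * N)"
    unfolding t15 t12_3 t12_6 t12_4 by (simp only: power2_eq_square mult_ac)
  also have "\<dots> = s6 * s18 * (t12 * a * b * x8 * s18 * u * o1 * o2 * o3)"
    unfolding N by (simp only: power2_eq_square mult_ac)
  finally have "s6 * s18 * (a * o2 - q * b * o1) = s6 * s18 * (t12 * a * b * x8 * s18 * u * o1 * o2 * o3)" .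
  then have main: "a * o2 - q * b * o1 = t12 * a * b * x8 * s18 * u * o1 * o2 * o3"
    using nz by simp
  have ER: "parts_prod q {n. n mod 72 \<in> R} = prod e R" if "finite R" for R
    using parts_prod_residues[OF q(1) that] by (simp add: e_def)
  have ES: "parts_prod q {n. n mod 72 \<in>
      {1, 3, 5, 7, 8, 9, 10, 11, 12, 13, 14, 16, 17, 18, 19, 23, 25, 27, 29, 31, 32, 33, 34, 35,
      71, 69, 67, 65, 64, 63, 62, 61, 60, 59, 58, 56, 55, 54, 53, 49, 47, 45, 43, 41, 40, 39, 38, 37}} = u * o1 * o3 * b * x8 * t12 * s18"
    by (subst ER) (simp_all add: defs mult_ac)
  have ET: "parts_prod q {n. n mod 72 \<in>
      {1, 2, 5, 7, 8, 9, 11, 12, 13, 15, 16, 17, 18, 19, 21, 22, 23, 25, 26, 27, 29, 31, 32, 35,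
      71, 70, 67, 65, 64, 63, 61, 60, 59, 57, 56, 55, 54, 53, 51, 50, 49, 47, 46, 45, 43, 41, 40, 37}} = u * o2 * o3 * a * x8 * t12 * s18"
    by (subst ER) (simp_all add: defs mult_ac)
  have "1 / (u * o1 * o3 * b * x8 * t12 * s18) - q / (u * o2 * o3 * a * x8 * t12 * s18) =
      (a * o2 - q * b * o1) / (t12 * a * b * x8 * s18 * u * o1 * o2 * o3)"
    using nz by (simp add: divide_simps)
  also have "\<dots> = 1" unfolding main using nz by simp
  finally show ?thesis unfolding ES ET .
qed

text \<open>Representatives strictly between 0 and m make r and m - r genuine remainders; they also
  exclude remainder 0, so k > 0 is automatic.\<close>

lemma pm_residue_class_eq:
  assumes "R \<subseteq> {0<..<int m}"
  shows "pm_residue_class m R = {n. n mod m \<in> (\<lambda>r. m - nat r) ` R \<union> nat ` R}"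
proof -
  have plus: "[int k = r] (mod int m) \<longleftrightarrow> k mod m = nat r" if "r \<in> R" for k r
  proof -
    have "0 < r" "r < int m" using assms that by auto
    then have "[int k = r] (mod int m) \<longleftrightarrow> int (k mod m) = r"
      unfolding Cong.cong_def zmod_int by simp
    with \<open>0 < r\<close> show ?thesis by auto
  qed
  have minus: "[int k = - r] (mod int m) \<longleftrightarrow> k mod m = m - nat r" if "r \<in> R" for k r
  proof -
    have "0 < r" "r < int m" using assms that by auto
    then have "(- r) mod int m = int (m - nat r)"
      by (simp add: zmod_zminus1_eq_if of_nat_diff)
    then have "[int k = - r] (mod int m) \<longleftrightarrow> int (k mod m) = int (m - nat r)"
      unfolding Cong.cong_def zmod_int by simp
    then show ?thesis by simp
  qed
  have "k > 0" if "k mod m = nat r \<or> k mod m = m - nat r" "r \<in> R" for k r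
  proof -
    have "0 < r" "r < int m" using assms that by auto
    then show ?thesis using that(1) by (cases k) auto
  qed
  then show ?thesis
    unfolding pm_residue_class_def using plus minus by (auto simp: image_iff)
qed

theorem theorem18p2:
  fixes S T :: "nat set" and n :: nat
  assumes "S = pm_residue_class 72
      {1, 3, 5, 7, 8, 9, 10, 11, 12, 13, 14, 16, 17, 18, 19, 23, 25, 27, 29, 31, 32, 33, 34, 35}"
    and "T = pm_residue_class 72
      {1, 2, 5, 7, 8, 9, 11, 12, 13, 15, 16, 17, 18, 19, 21, 22, 23, 25, 26, 27, 29, 31, 32, 35}"
    and "n \<ge> 1"
  shows "partition_count S n = partition_count T (n - 1)"
proof -
  have S: "S = {n. n mod 72 \<in>
      {1, 3, 5, 7, 8, 9, 10, 11, 12, 13, 14, 16, 17, 18, 19, 23, 25, 27, 29, 31, 32, 33, 34, 35,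
      71, 69, 67, 65, 64, 63, 62, 61, 60, 59, 58, 56, 55, 54, 53, 49, 47, 45, 43, 41, 40, 39, 38, 37}}"
    unfolding assms(1) by (subst pm_residue_class_eq) simp_all
  have T: "T = {n. n mod 72 \<in>
      {1, 2, 5, 7, 8, 9, 11, 12, 13, 15, 16, 17, 18, 19, 21, 22, 23, 25, 26, 27, 29, 31, 32, 35,
      71, 70, 67, 65, 64, 63, 61, 60, 59, 57, 56, 55, 54, 53, 51, 50, 49, 47, 46, 45, 43, 41, 40, 37}}"
    unfolding assms(2) by (subst pm_residue_class_eq) simp_all
  have "0 \<notin> S" "0 \<notin> T" unfolding S T by simp_all
  \<comment> \<open>The coefficients of F_S(q) - q F_T(q) - 1 for the generating functions F_S and
    F_T; the value 1 at index 0 accounts for the constant.\<close>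
  define d :: "nat \<Rightarrow> complex" where
    "d n = of_nat (partition_count S n) - (case n of 0 \<Rightarrow> 1 | Suc k \<Rightarrow> of_nat (partition_count T k))" for n
  have sums: "(\<lambda>n. d n * (q - 0) ^ n) sums 0" if "norm (q - 0) < 1" for q
  \<comment> \<open>The product identity assumes q nonzero; at q = 0 only the coefficient
    \<open>d 0\<close> matters.\<close>
  proof (cases "q = 0")
    case True
    have "S \<inter> {..<1} = {}" using \<open>0 \<notin> S\<close> by auto
    then have "partition_count S 0 = 1"
      using partition_count_lessThan[of 0 1 S] by (simp add: partition_count_empty)
    then show ?thesis using True powser_sums_zero[of d] by (simp add: d_def)
  next
    case False
    from that have q: "norm q < 1" by simp
    have "(\<lambda>n. of_nat (partition_count T n) * q ^ Suc n) sums (q * (1 / parts_prod q T))"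
      using sums_mult[OF partition_count_sums[OF \<open>0 \<notin> T\<close> q], of q] by (simp add: mult_ac)
    then have "(\<lambda>n. (case n of 0 \<Rightarrow> 1 | Suc k \<Rightarrow> of_nat (partition_count T k)) * q ^ n) sums
        (q * (1 / parts_prod q T) + 1)"
      using sums_Suc[of "\<lambda>n. (case n of 0 \<Rightarrow> 1 | Suc k \<Rightarrow> of_nat (partition_count T k)) * q ^ n"] by simp
    from sums_diff[OF partition_count_sums[OF \<open>0 \<notin> S\<close> q] this]
    have "(\<lambda>n. d n * q ^ n) sums (1 / parts_prod q S - (q * (1 / parts_prod q T) + 1))"
      by (simp add: d_def left_diff_distrib)
    moreover have "1 / parts_prod q S - q / parts_prod q T = 1"
      unfolding S T by (rule product_identity_72[OF q False])
    ultimately show ?thesis by (simp add: algebra_simps)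
  qed
  \<comment> \<open>Isolated zeros: a power series that vanishes at its centre and has a nonzero
    coefficient of positive index is nonzero on a punctured disc, whereas this one sums to 0
    throughout. Here n \<ge> 1 provides the positive index.\<close>
  have "d n = 0"
  proof (rule ccontr)
    assume "d n \<noteq> 0"
    then obtain s :: real where "s > 0" "\<And>z::complex. z \<in> cball 0 s - {0} \<Longrightarrow> (0::complex) \<noteq> 0"
      using powser_0_nonzero[of 1 0 d "\<lambda>_. 0" n, OF _ sums] \<open>n \<ge> 1\<close> by auto
    from this(2)[of "of_real s"] \<open>s > 0\<close> show False by simp
  qed
  then have "of_nat (partition_count S n) = (of_nat (partition_count T (n - 1)) :: complex)"
    using \<open>n \<ge> 1\<close> by (cases n) (auto simp: d_def)
  then show ?thesis by (simp only: of_nat_eq_iff)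
qed

end
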